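(* Let $p\in(1,\infty)$ and let $\Gamma$ be a finite family of objects on a finite weighted graph $G=(V,E,\sigma)$, with usage matrix $\mathcal{N}$. Then: (i) A minimal subfamily $\tilde\Gamma\subset\Gamma$ for $\operatorname{Mod}_{p,\sigma}(\Gamma)$ always exists. (ii) If $\tilde\Gamma$ is a minimal subfamily for $\operatorname{Mod}_{p,\sigma}(\Gamma)$, then there exists a unique optimal $\lambda^*$ for the dual problem of $\Gamma$ such that $\tilde\Gamma=\Gamma_{\lambda^*}$. In particular, $\tilde\Gamma$ is a Beurling subfamily of $\Gamma$ for $\operatorname{Mod}_{p,\sigma}(\Gamma)$. (iii) The objects in a minimal subfamily $\tilde\Gamma$ are linearly independent, in the sense that $\operatorname{rank}\mathcal{N}(\tilde\Gamma)=|\tilde\Gamma|$. (iv) In particular, every minimal subfamily $\tilde\Gamma$ satisfies $|\tilde\Gamma|\le |E|$, where $|E|$ is the number of edges. (v) Moreover, if $\Gamma$ is itself minimal (i.e. $\Gamma$ is a minimal subfamily of $\Gamma$ for $\operatorname{Mod}_{p,\sigma}(\Gamma)$), then the optimizer of the dual problem of $\Gamma$ is unique.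
   Context: $G=(V,E,\sigma)$ is a finite graph with edge weights $0<\sigma(e)<\infty$ for $e\in E$. A family of objects $\Gamma$ is a set together with a usage matrix $\mathcal{N}=[\mathcal{N}(\gamma,e)]_{\gamma\in\Gamma,e\in E}$ with entries $\mathcal{N}(\gamma,e)\ge 0$, such that every $\gamma\in\Gamma$ has $\mathcal{N}(\gamma,e)>0$ for at least one $e\in E$. For $\tilde\Gamma\subset\Gamma$, $\mathcal{N}(\tilde\Gamma)$ is the submatrix of rows indexed by $\tilde\Gamma$. For $\rho\in\mathbb{R}^E$ put $\ell_\rho(\gamma)=\sum_{e\in E}\mathcal{N}(\gamma,e)\rho(e)$. The admissible set is $\operatorname{Adm}(\Gamma)=\{\rho\in\mathbb{R}_{\ge0}^E:\ \ell_\rho(\gamma)\ge 1\ \forall\gamma\in\Gamma\}$. For $1<p<\infty$, $$\operatorname{Mod}_{p,\sigma}(\Gamma)=\inf_{\rho\in\operatorname{Adm}(\Gamma)}\sum_{e\in E}\sigma(e)|\rho(e)|^p ,$$ and a unique minimizer $\rho^*$, called the extremal density, exists. The dual problem of $\Gamma$ is to maximize, over $\lambda\in\mathbb{R}_{\ge0}^{\Gamma}$, $$g(\lambda)=\sum_{\gamma\in\Gamma}\lambda(\gamma)-(p-1)\sum_{e\in E}\sigma(e)\left(\frac{1}{p\,\sigma(e)}\sum_{\gamma\in\Gamma}\lambda(\gamma)\mathcal{N}(\gamma,e)\right)^{\frac{p}{p-1}} .$$ A maximizer is called optimal. For an optimal $\lambda^*$, set $\Gamma_{\lambda^*}=\{\gamma\in\Gamma:\lambda^*(\gamma)>0\}$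 (the Lagrangian subfamily associated to $\lambda^*$). A subfamily $\tilde\Gamma\subset\Gamma$ is a Beurling subfamily of $\Gamma$ for $\operatorname{Mod}_{p,\sigma}(\Gamma)$ if the extremal density $\rho^*$ of $\Gamma$ satisfies $\ell_{\rho^*}(\gamma)=1$ for all $\gamma\in\tilde\Gamma$ and, whenever $h\in\mathbb{R}^E$ satisfies $\ell_h(\gamma)\ge 0$ for all $\gamma\in\tilde\Gamma$, one has $\sum_{e\in E}h(e)\rho^*(e)^{p-1}\sigma(e)\ge 0$. A subfamily $\tilde\Gamma\subset\Gamma$ is a minimal subfamily of $\Gamma$ for $\operatorname{Mod}_{p,\sigma}(\Gamma)$ if $\operatorname{Mod}_{p,\sigma}(\tilde\Gamma)=\operatorname{Mod}_{p,\sigma}(\Gamma)$ and, for every $\gamma\in\tilde\Gamma$, $\operatorname{Mod}_{p,\sigma}(\tilde\Gamma\setminus\{\gamma\})<\operatorname{Mod}_{p,\sigma}(\Gamma)$. *)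

theory Defs
  imports
    Complex_Main
    "HOL-Library.FuncSet"
    "HOL-Library.Countable_Set"
    "Jordan_Normal_Form.DL_Rank"
begin

text \<open>
  Edges are abstract names; \<open>ends e\<close> is the set of one or two end vertices of \<open>e\<close>, so parallel
  edges and loops are allowed. For a simple graph take \<open>ends\<close> to be the identity.
\<close>

locale weighted_graph =
  fixes V :: "'v set" and E :: "'e set" and ends :: "'e \<Rightarrow> 'v set" and \<sigma> :: "'e \<Rightarrow> real"
  assumes finite_V: "finite V"
    and finite_E: "finite E"
    and ends_subset: "\<And>e. e \<in> E \<Longrightarrow> ends e \<subseteq> V"
    and card_ends: "\<And>e. e \<in> E \<Longrightarrow> card (ends e) \<in> {1, 2}"
    and weight_pos: "\<And>e. e \<in> E \<Longrightarrow> 0 < \<sigma> e"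

locale object_family = weighted_graph V E ends \<sigma>
  for V :: "'v set" and E :: "'e set" and ends :: "'e \<Rightarrow> 'v set" and \<sigma> :: "'e \<Rightarrow> real" +
  fixes \<Gamma> :: "'g set" and N :: "'g \<Rightarrow> 'e \<Rightarrow> real"
  assumes usage_nonneg: "\<And>\<gamma> e. \<gamma> \<in> \<Gamma> \<Longrightarrow> e \<in> E \<Longrightarrow> 0 \<le> N \<gamma> e"
    and usage_nontrivial: "\<And>\<gamma>. \<gamma> \<in> \<Gamma> \<Longrightarrow> \<exists>e\<in>E. 0 < N \<gamma> e"

text \<open>
  Vectors indexed by a set \<open>I\<close> are extensional functions, i.e. elements of \<open>I \<rightarrow>\<^sub>E UNIV\<close>
  (or \<open>I \<rightarrow>\<^sub>E {0..}\<close> for nonnegative ones), so that equality of vectors is equality of functions.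
\<close>

definition usage_length :: "'e set \<Rightarrow> ('g \<Rightarrow> 'e \<Rightarrow> real) \<Rightarrow> ('e \<Rightarrow> real) \<Rightarrow> 'g \<Rightarrow> real" where
  "usage_length E N \<rho> \<gamma> = (\<Sum>e\<in>E. N \<gamma> e * \<rho> e)"

definition Adm :: "'e set \<Rightarrow> ('g \<Rightarrow> 'e \<Rightarrow> real) \<Rightarrow> 'g set \<Rightarrow> ('e \<Rightarrow> real) set" where
  "Adm E N \<Gamma> = {\<rho> \<in> E \<rightarrow>\<^sub>E {0..}. \<forall>\<gamma>\<in>\<Gamma>. 1 \<le> usage_length E N \<rho> \<gamma>}"

definition energy :: "'e set \<Rightarrow> ('e \<Rightarrow> real) \<Rightarrow> real \<Rightarrow> ('e \<Rightarrow> real) \<Rightarrow> real" where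
  "energy E \<sigma> p \<rho> = (\<Sum>e\<in>E. \<sigma> e * \<bar>\<rho> e\<bar> powr p)"

definition Modulus ::
  "'e set \<Rightarrow> ('e \<Rightarrow> real) \<Rightarrow> real \<Rightarrow> ('g \<Rightarrow> 'e \<Rightarrow> real) \<Rightarrow> 'g set \<Rightarrow> real" where
  "Modulus E \<sigma> p N \<Gamma> = (INF \<rho>\<in>Adm E N \<Gamma>. energy E \<sigma> p \<rho>)"

definition extremal_density ::
  "'e set \<Rightarrow> ('e \<Rightarrow> real) \<Rightarrow> real \<Rightarrow> ('g \<Rightarrow> 'e \<Rightarrow> real) \<Rightarrow> 'g set \<Rightarrow> ('e \<Rightarrow> real) \<Rightarrow> bool" where
  "extremal_density E \<sigma> p N \<Gamma> \<rho> \<longleftrightarrow> \<rho> \<in> Adm E N \<Gamma> \<and> energy E \<sigma> p \<rho> = Modulus E \<sigma> p N \<Gamma>"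

definition dual_objective ::
  "'e set \<Rightarrow> ('e \<Rightarrow> real) \<Rightarrow> real \<Rightarrow> ('g \<Rightarrow> 'e \<Rightarrow> real) \<Rightarrow> 'g set \<Rightarrow> ('g \<Rightarrow> real) \<Rightarrow> real" where
  "dual_objective E \<sigma> p N \<Gamma> \<mu> =
     (\<Sum>\<gamma>\<in>\<Gamma>. \<mu> \<gamma>) -
     (p - 1) * (\<Sum>e\<in>E. \<sigma> e * (1 / (p * \<sigma> e) * (\<Sum>\<gamma>\<in>\<Gamma>. \<mu> \<gamma> * N \<gamma> e)) powr (p / (p - 1)))"

definition dual_optimal ::
  "'e set \<Rightarrow> ('e \<Rightarrow> real) \<Rightarrow> real \<Rightarrow> ('g \<Rightarrow> 'e \<Rightarrow> real) \<Rightarrow> 'g set \<Rightarrow> ('g \<Rightarrow> real) \<Rightarrow> bool" where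
  "dual_optimal E \<sigma> p N \<Gamma> =
     is_arg_max (dual_objective E \<sigma> p N \<Gamma>) (\<lambda>\<mu>. \<mu> \<in> \<Gamma> \<rightarrow>\<^sub>E {0..})"

definition lagrangian_subfamily :: "'g set \<Rightarrow> ('g \<Rightarrow> real) \<Rightarrow> 'g set" where
  "lagrangian_subfamily \<Gamma> \<mu> = {\<gamma> \<in> \<Gamma>. 0 < \<mu> \<gamma>}"

text \<open>
  The extremal density exists and is unique for \<open>p > 1\<close>, so the existential quantifier
  below refers to that one density.
\<close>

definition beurling_subfamily ::
  "'e set \<Rightarrow> ('e \<Rightarrow> real) \<Rightarrow> real \<Rightarrow> ('g \<Rightarrow> 'e \<Rightarrow> real) \<Rightarrow> 'g set \<Rightarrow> 'g set \<Rightarrow> bool" where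
  "beurling_subfamily E \<sigma> p N \<Gamma> \<Delta> \<longleftrightarrow> \<Delta> \<subseteq> \<Gamma> \<and>
     (\<exists>\<rho>. extremal_density E \<sigma> p N \<Gamma> \<rho> \<and>
        (\<forall>\<gamma>\<in>\<Delta>. usage_length E N \<rho> \<gamma> = 1) \<and>
        (\<forall>h \<in> E \<rightarrow>\<^sub>E UNIV. (\<forall>\<gamma>\<in>\<Delta>. 0 \<le> usage_length E N h \<gamma>) \<longrightarrow>
           0 \<le> (\<Sum>e\<in>E. h e * \<rho> e powr (p - 1) * \<sigma> e)))"

definition minimal_subfamily ::
  "'e set \<Rightarrow> ('e \<Rightarrow> real) \<Rightarrow> real \<Rightarrow> ('g \<Rightarrow> 'e \<Rightarrow> real) \<Rightarrow> 'g set \<Rightarrow> 'g set \<Rightarrow> bool" where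
  "minimal_subfamily E \<sigma> p N \<Gamma> \<Delta> \<longleftrightarrow> \<Delta> \<subseteq> \<Gamma> \<and>
     Modulus E \<sigma> p N \<Delta> = Modulus E \<sigma> p N \<Gamma> \<and>
     (\<forall>\<gamma>\<in>\<Delta>. Modulus E \<sigma> p N (\<Delta> - {\<gamma>}) < Modulus E \<sigma> p N \<Gamma>)"

text \<open>
  \<open>from_nat_into S\<close> restricts to a bijection from \<open>{..<card S}\<close> to \<open>S\<close> for every finite \<open>S\<close>;
  the rank does not depend on the chosen ordering of rows and columns.
\<close>

definition usage_matrix ::
  "'e set \<Rightarrow> ('g \<Rightarrow> 'e \<Rightarrow> real) \<Rightarrow> 'g set \<Rightarrow> real Matrix.mat" where
  "usage_matrix E N \<Delta> =
     Matrix.mat (card \<Delta>) (card E) (\<lambda>(i, j). N (from_nat_into \<Delta> i) (from_nat_into E j))"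

text \<open>The first argument of \<open>vec_space.rank\<close> is the number of rows.\<close>

definition matrix_rank :: "real Matrix.mat \<Rightarrow> nat" where
  "matrix_rank A = vec_space.rank (dim_row A) A"

end

theory Submission
  imports Defs "HOL-Analysis.Function_Topology"
begin

text \<open>
  The whole argument runs on the Lagrangian
  \<open>L(\<rho>, \<mu>) = energy(\<rho>) + \<Sum>\<gamma>. \<mu>(\<gamma>) (1 - len \<rho> \<gamma>)\<close>. For a fixed multiplier \<open>\<mu> \<ge> 0\<close> it
  splits into one convex function of \<open>\<rho>(e)\<close> per edge, and Young's inequality minimizes each of
  these. The minimum is exactly the dual objective \<open>g(\<mu>)\<close>, and it is attained at a single
  density \<open>dens \<mu>\<close>, given by \<open>p \<sigma>(e) \<rho>(e)^(p-1) = load \<mu> e\<close> with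
  \<open>load \<mu> e = \<Sum>\<gamma>. \<mu>(\<gamma>) N(\<gamma>, e)\<close>
  (\<open>dual_le_lagrangian\<close>, \<open>dual_eq_lagrangian_dens\<close>).

  The dual problem is solved first. A density of length at least 2 along every object makes
  \<open>g\<close> negative outside a compact box, so a maximizer \<open>\<mu>\<close> exists (\<open>dual_optimal_exists\<close>). Since
  \<open>g(\<mu>) \<le> L(dens \<nu>, \<mu>)\<close> with equality at \<open>\<mu> = \<nu>\<close>, the numbers \<open>1 - len (dens \<nu>) \<gamma>\<close> form a
  supergradient of \<open>g\<close> at \<open>\<nu>\<close>. Comparing \<open>\<mu>\<close> with multipliers that differ from it in a single
  coordinate shows that \<open>dens \<mu>\<close> is admissible and has length 1 wherever \<open>\<mu> > 0\<close>
  (\<open>optimal_kkt\<close>). Hence \<open>dens \<mu>\<close> is the extremal density and \<open>g(\<mu>)\<close> is the modulus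
  (\<open>optimal_strong_duality\<close>). By strictness in Young's
  inequality all optimal multipliers yield the same density and therefore the same loads.

  Strong duality for \<open>\<Gamma>\<close> and for \<open>\<Delta> \<subseteq> \<Gamma>\<close> together says that \<open>\<Delta>\<close> has the modulus of \<open>\<Gamma>\<close> iff
  some optimal multiplier of \<open>\<Gamma>\<close> is supported in \<open>\<Delta>\<close> (\<open>modulus_eq_iff_optimal_support\<close>). So the
  minimal subfamilies are the inclusion-minimal supports of optimal multipliers. If the rows of
  a minimal \<open>\<Delta>\<close> satisfied a linear relation \<open>c\<close>, then sliding the multiplier along \<open>c\<close> would
  change neither the loads nor, because all lengths are 1, the total mass; it would stay optimal
  until a coordinate reaches 0, and its support would shrink (\<open>minimal_independent\<close>).
  Independence gives the rank, hence the bound by the number of edges, and also the uniqueness of the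
  multiplier, because two optimal multipliers have equal loads. If \<open>\<Gamma>\<close> itself is minimal, every
  optimal multiplier has full support, so the optimizer is unique.
\<close>

section \<open>Young's inequality and its equality case\<close>

text \<open>
  For \<open>u = y powr (1 / (p - 1))\<close> the claim says that \<open>t \<mapsto> t powr p\<close> lies strictly above its tangent
  at \<open>u\<close>. The mean value theorem is applied to the difference of the two, whose derivative has
  the sign of \<open>t - u\<close>. Strictness is what later makes extremal densities and loads unique.
\<close>

lemma strict_Young:
  fixes p x y :: real
  assumes p: "1 < p" and x: "0 \<le> x" and y: "0 \<le> y" and ne: "x \<noteq> y powr (1 / (p - 1))"
  shows "p * x * y < x powr p + (p - 1) * y powr (p / (p - 1))"
proof -
  define u where "u = y powr (1 / (p - 1))"
  have u0: "0 \<le> u" and yu: "y = u powr (p - 1)" and qu: "y powr (p / (p - 1)) = u powr p"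
    using p y by (auto simp: u_def powr_powr)
  show ?thesis
  \<comment> \<open>With a vanishing argument the left-hand side is 0; the derivative is needed only between positive arguments.\<close>
  proof (cases "x = 0 \<or> u = 0")
    case True
    then show ?thesis
    proof
      assume "x = 0"
      then have "0 < u" using ne u0 by (auto simp: u_def)
      then show ?thesis using \<open>x = 0\<close> p qu by simp
    next
      assume "u = 0"
      then have "0 < x" using ne x by (auto simp: u_def)
      then show ?thesis using \<open>u = 0\<close> p yu by simp
    qed
  next
    case False
    then have pos: "0 < x" "0 < u" using x u0 by auto
    define f where "f t = t powr p - p * u powr (p - 1) * t" for t
    have D: "DERIV f t :> p * (t powr (p - 1) - u powr (p - 1))" if "0 < t" for t
      unfolding f_def using that by (auto intro!: derivative_eq_intros simp: algebra_simps)
    have "f u < f x"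
    proof (cases "u < x")
      case True
      then obtain z where z: "u < z" "z < x"
        "f x - f u = (x - u) * (p * (z powr (p - 1) - u powr (p - 1)))"
        using MVT2[of u x f, OF _ D] pos by (metis less_le_trans)
      have "u powr (p - 1) < z powr (p - 1)" using z pos p by (intro powr_less_mono2) auto
      then have "0 < f x - f u" using z p True by simp
      then show ?thesis by simp
    next
      case False
      then have "x < u" using ne u_def by auto
      then obtain z where z: "x < z" "z < u"
        "f u - f x = (u - x) * (p * (z powr (p - 1) - u powr (p - 1)))"
        using MVT2[of x u f, OF _ D] pos by (metis less_le_trans)
      have "z powr (p - 1) < u powr (p - 1)" using z pos p by (intro powr_less_mono2) auto
      then have "f u - f x < 0" using z p \<open>x < u\<close> by (simp add: mult_pos_neg)
      then show ?thesis by simp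
    qed
    moreover have "u powr (p - 1) * u = u powr p" using pos by (simp add: powr_diff)
    ultimately show ?thesis unfolding f_def qu by (simp add: yu algebra_simps)
  qed
qed

lemma Young_eq:
  fixes p x y :: real
  assumes p: "1 < p" and y: "0 \<le> y" and x: "x = y powr (1 / (p - 1))"
  shows "p * x * y = x powr p + (p - 1) * y powr (p / (p - 1))"
proof (cases "y = 0")
  case False
  have "1 / (p - 1) + 1 = p / (p - 1)" using p by (simp add: field_simps)
  then have "x * y = y powr (p / (p - 1))" unfolding x using y False
    by (metis abs_of_nonneg powr_add powr_one)
  moreover have "x powr p = y powr (p / (p - 1))" unfolding x by (simp add: powr_powr)
  ultimately show ?thesis by (simp add: algebra_simps)
qed (use x p in simp)

section \<open>Full row rank from independent rows\<close>

text \<open>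
  The Gram matrix \<open>A A\<^sup>T\<close> is invertible: \<open>A A\<^sup>T c = 0\<close> forces \<open>A\<^sup>T c\<close> to be orthogonal to itself.
  So every vector \<open>y\<close> equals \<open>A (A\<^sup>T (A A\<^sup>T)\<inverse> y)\<close> and lies in the column space.
\<close>

lemma rank_eq_dim_row_if_rows_independent:
  fixes A :: "real Matrix.mat"
  assumes A: "A \<in> carrier_mat n m"
    and indep: "\<And>c. c \<in> carrier_vec n \<Longrightarrow> A\<^sup>T *\<^sub>v c = 0\<^sub>v m \<Longrightarrow> c = 0\<^sub>v n"
  shows "vec_space.rank n A = n"
proof -
  have T: "A\<^sup>T \<in> carrier_mat m n" using A by simp
  have G: "A * A\<^sup>T \<in> carrier_mat n n" using A by simp
  have "Determinant.det (A * A\<^sup>T) \<noteq> 0"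
  proof
    assume "Determinant.det (A * A\<^sup>T) = 0"
    then obtain c where c: "c \<in> carrier_vec n" "c \<noteq> 0\<^sub>v n" "A * A\<^sup>T *\<^sub>v c = 0\<^sub>v n"
      using det_0_iff_vec_prod_zero_field[OF G] by blast
    define w where "w = A\<^sup>T *\<^sub>v c"
    have w: "w \<in> carrier_vec m" using T c by (simp add: w_def)
    have "A *\<^sub>v w = 0\<^sub>v n"
      using c(3) unfolding w_def assoc_mult_mat_vec[OF A T c(1)] .
    then have "c \<bullet> (A *\<^sub>v w) = 0" using c(1) by simp
    moreover have "(A\<^sup>T *\<^sub>v c) \<bullet> w = c \<bullet> (A *\<^sub>v w)"
      by (rule transpose_vec_mult_scalar[OF A w c(1)])
    ultimately have "w \<bullet>c w = 0" by (simp add: w_def)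
    then have "w = 0\<^sub>v m" using conjugate_square_eq_0_vec[OF w] by simp
    then show False using indep[OF c(1)] c(2) by (simp add: w_def)
  qed
  then obtain B where B: "B \<in> carrier_mat n n" "A * A\<^sup>T * B = 1\<^sub>m n"
    using det_non_zero_imp_unit[OF G, of "()"] unfolding Units_def ring_mat_def by auto
  interpret vec_space "TYPE(real)" n .
  have "y \<in> span (set (cols A))" if y: "y \<in> carrier_vec n" for y
  proof -
    define x where "x = A\<^sup>T *\<^sub>v (B *\<^sub>v y)"
    have By: "B *\<^sub>v y \<in> carrier_vec n" using B y by simp
    have "A *\<^sub>v x = (A * A\<^sup>T) *\<^sub>v (B *\<^sub>v y)"
      unfolding x_def by (rule assoc_mult_mat_vec[OF A T By, symmetric])
    also have "\<dots> = (A * A\<^sup>T * B) *\<^sub>v y" by (rule assoc_mult_mat_vec[OF G B(1) y, symmetric])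
    also have "\<dots> = y" using B(2) y by simp
    finally have "A *\<^sub>v x = y" .
    moreover have "x \<in> carrier_vec m" using T By by (simp add: x_def)
    ultimately have "y \<in> col_space A" using col_space_eq[OF A] A y by auto
    then show ?thesis by (simp add: col_space_def)
  qed
  moreover have "span (set (cols A)) \<subseteq> carrier_vec n"
    using span_closed cols_dim[of A] A by auto
  ultimately have sp: "span (set (cols A)) = carrier_vec n" by blast
  have "vs (carrier_vec n) = V" by (simp add: module_vec_def)
  then show ?thesis unfolding rank_def sp using dim_is_n by metis
qed

section \<open>The Lagrangian and the dual objective\<close>

definition load :: "('g \<Rightarrow> 'e \<Rightarrow> real) \<Rightarrow> 'g set \<Rightarrow> ('g \<Rightarrow> real) \<Rightarrow> 'e \<Rightarrow> real" where
  "load N \<Gamma> \<mu> e = (\<Sum>\<gamma>\<in>\<Gamma>. \<mu> \<gamma> * N \<gamma> e)"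

text \<open>
  This is the minimizer of the Lagrangian in the density for a fixed multiplier.
\<close>

definition dual_density ::
  "'e set \<Rightarrow> ('e \<Rightarrow> real) \<Rightarrow> real \<Rightarrow> ('g \<Rightarrow> 'e \<Rightarrow> real) \<Rightarrow> 'g set \<Rightarrow> ('g \<Rightarrow> real) \<Rightarrow> 'e \<Rightarrow> real" where
  "dual_density E \<sigma> p N \<Gamma> \<mu> = (\<lambda>e\<in>E. (load N \<Gamma> \<mu> e / (p * \<sigma> e)) powr (1 / (p - 1)))"

definition lagrangian ::
  "'e set \<Rightarrow> ('e \<Rightarrow> real) \<Rightarrow> real \<Rightarrow> ('g \<Rightarrow> 'e \<Rightarrow> real) \<Rightarrow> 'g set \<Rightarrow> ('e \<Rightarrow> real) \<Rightarrow> ('g \<Rightarrow> real) \<Rightarrow> real"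
  where "lagrangian E \<sigma> p N \<Gamma> \<rho> \<mu> =
    energy E \<sigma> p \<rho> + (\<Sum>\<gamma>\<in>\<Gamma>. \<mu> \<gamma> * (1 - usage_length E N \<rho> \<gamma>))"

text \<open>
  Weighting objects by \<open>\<mu>\<close> and then measuring them by \<open>\<rho>\<close> is a bilinear pairing; this is its
  edge-wise form, in which the Lagrangian decouples.
\<close>

lemma sum_mult_usage_length:
  "(\<Sum>\<gamma>\<in>\<Gamma>. \<mu> \<gamma> * usage_length E N \<rho> \<gamma>) = (\<Sum>e\<in>E. load N \<Gamma> \<mu> e * \<rho> e)"
  unfolding usage_length_def load_def sum_distrib_left sum_distrib_right
  by (subst sum.swap) (simp add: mult.assoc)

lemma dual_objective_load:
  "dual_objective E \<sigma> p N \<Gamma> \<mu> =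
    sum \<mu> \<Gamma> - (p - 1) * (\<Sum>e\<in>E. \<sigma> e * (load N \<Gamma> \<mu> e / (p * \<sigma> e)) powr (p / (p - 1)))"
  by (simp add: dual_objective_def load_def)

text \<open>
  Multipliers of a subfamily are the multipliers of the full family that vanish outside it. This
  carries optimal multipliers back and forth between the two dual problems.
\<close>

lemma dual_objective_subfamily:
  assumes "finite \<Gamma>" and "\<Delta> \<subseteq> \<Gamma>"
    and "\<forall>\<gamma>\<in>\<Delta>. \<nu> \<gamma> = \<mu> \<gamma>" and "\<forall>\<gamma>\<in>\<Gamma> - \<Delta>. \<mu> \<gamma> = 0"
  shows "dual_objective E \<sigma> p N \<Delta> \<nu> = dual_objective E \<sigma> p N \<Gamma> \<mu>"
proof -
  have "(\<Sum>\<gamma>\<in>\<Gamma>. \<mu> \<gamma> * w \<gamma>) = (\<Sum>\<gamma>\<in>\<Delta>. \<nu> \<gamma> * w \<gamma>)" for w :: "'a \<Rightarrow> real"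
    using assms by (intro sum.mono_neutral_cong_right) auto
  from this[of "\<lambda>_. 1"] this show ?thesis
    by (simp add: dual_objective_def)
qed

locale finite_object_family = object_family V E ends \<sigma> \<Gamma> N
  for V :: "'v set" and E :: "'e set" and ends and \<sigma> and \<Gamma> :: "'g set" and N +
  fixes p :: real
  assumes p_gt_1: "1 < p" and finite_family: "finite \<Gamma>"
begin

abbreviation len where "len \<equiv> usage_length E N"
abbreviation modul where "modul \<equiv> Modulus E \<sigma> p N"
abbreviation dual where "dual \<equiv> dual_objective E \<sigma> p N \<Gamma>"
abbreviation optimal where "optimal \<equiv> dual_optimal E \<sigma> p N \<Gamma>"
abbreviation dens where "dens \<equiv> dual_density E \<sigma> p N \<Gamma>"
abbreviation Lag where "Lag \<equiv> lagrangian E \<sigma> p N \<Gamma>"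

lemma subfamily:
  assumes "\<Delta> \<subseteq> \<Gamma>"
  shows "finite_object_family V E ends \<sigma> \<Delta> N p"
proof
  show "finite \<Delta>" using assms finite_family finite_subset by blast
qed (use assms usage_nonneg usage_nontrivial p_gt_1 in blast)+

lemma load_nonneg: "e \<in> E \<Longrightarrow> \<forall>\<gamma>\<in>\<Gamma>. 0 \<le> \<mu> \<gamma> \<Longrightarrow> 0 \<le> load N \<Gamma> \<mu> e"
  unfolding load_def by (intro sum_nonneg) (simp add: usage_nonneg)

lemma dens_PiE: "dens \<mu> \<in> E \<rightarrow>\<^sub>E {0..}"
  by (auto simp: dual_density_def)

text \<open>
  The duality gap is a sum over edges of the gaps in Young's inequality for \<open>\<rho> e\<close> and the
  rescaled load. Everything below about weak duality, strong duality and uniqueness is read off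
  from this identity.
\<close>

lemma lagrangian_gap:
  "Lag \<rho> \<mu> - dual \<mu> = (\<Sum>e\<in>E. \<sigma> e * (\<bar>\<rho> e\<bar> powr p
      + (p - 1) * (load N \<Gamma> \<mu> e / (p * \<sigma> e)) powr (p / (p - 1))
      - p * \<rho> e * (load N \<Gamma> \<mu> e / (p * \<sigma> e))))" (is "_ = ?R")
proof -
  have "Lag \<rho> \<mu> - dual \<mu> = energy E \<sigma> p \<rho> - (\<Sum>e\<in>E. load N \<Gamma> \<mu> e * \<rho> e)
      + (p - 1) * (\<Sum>e\<in>E. \<sigma> e * (load N \<Gamma> \<mu> e / (p * \<sigma> e)) powr (p / (p - 1)))"
    unfolding lagrangian_def dual_objective_load sum_mult_usage_length[symmetric]
    by (simp add: right_diff_distrib sum_subtractf)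
  also have "\<dots> = (\<Sum>e\<in>E. \<sigma> e * \<bar>\<rho> e\<bar> powr p - load N \<Gamma> \<mu> e * \<rho> e
      + (p - 1) * (\<sigma> e * (load N \<Gamma> \<mu> e / (p * \<sigma> e)) powr (p / (p - 1))))"
    unfolding energy_def by (simp add: sum.distrib sum_subtractf sum_distrib_left)
  also have "\<dots> = ?R"
  proof (rule sum.cong)
    fix e assume "e \<in> E"
    then have "\<sigma> e * (p * \<rho> e * (load N \<Gamma> \<mu> e / (p * \<sigma> e))) = load N \<Gamma> \<mu> e * \<rho> e"
      using weight_pos[of e] p_gt_1 by (simp add: field_simps)
    then show "\<sigma> e * \<bar>\<rho> e\<bar> powr p - load N \<Gamma> \<mu> e * \<rho> e
      + (p - 1) * (\<sigma> e * (load N \<Gamma> \<mu> e / (p * \<sigma> e)) powr (p / (p - 1)))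
      = \<sigma> e * (\<bar>\<rho> e\<bar> powr p
      + (p - 1) * (load N \<Gamma> \<mu> e / (p * \<sigma> e)) powr (p / (p - 1))
      - p * \<rho> e * (load N \<Gamma> \<mu> e / (p * \<sigma> e)))"
      by (simp add: algebra_simps)
  qed simp
  finally show ?thesis .
qed

lemma dual_eq_lagrangian_dens:
  assumes "\<forall>\<gamma>\<in>\<Gamma>. 0 \<le> \<mu> \<gamma>"
  shows "dual \<mu> = Lag (dens \<mu>) \<mu>"
proof -
  have "Lag (dens \<mu>) \<mu> - dual \<mu> = 0"
    unfolding lagrangian_gap
  proof (rule sum.neutral, intro ballI)
    fix e assume e: "e \<in> E"
    let ?y = "load N \<Gamma> \<mu> e / (p * \<sigma> e)"
    have y: "0 \<le> ?y" using load_nonneg[OF e assms] weight_pos[OF e] p_gt_1 by simp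
    have d: "dens \<mu> e = ?y powr (1 / (p - 1))" using e by (simp add: dual_density_def)
    show "\<sigma> e * (\<bar>dens \<mu> e\<bar> powr p + (p - 1) * ?y powr (p / (p - 1)) - p * dens \<mu> e * ?y) = 0"
      using Young_eq[OF p_gt_1 y d] d by simp
  qed
  then show ?thesis by simp
qed

text \<open>
  Weak duality. Equality forces equality in Young's inequality on every edge, which pins down the
  density.
\<close>

lemma dual_le_lagrangian:
  assumes \<mu>: "\<forall>\<gamma>\<in>\<Gamma>. 0 \<le> \<mu> \<gamma>" and \<rho>: "\<rho> \<in> E \<rightarrow>\<^sub>E {0..}"
  shows "dual \<mu> \<le> Lag \<rho> \<mu>" and "dual \<mu> = Lag \<rho> \<mu> \<Longrightarrow> \<rho> = dens \<mu>"
proof -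
  let ?y = "\<lambda>e. load N \<Gamma> \<mu> e / (p * \<sigma> e)"
  let ?f = "\<lambda>e. \<sigma> e * (\<bar>\<rho> e\<bar> powr p + (p - 1) * ?y e powr (p / (p - 1)) - p * \<rho> e * ?y e)"
  have y: "0 \<le> ?y e" if "e \<in> E" for e
    using load_nonneg[OF that \<mu>] weight_pos[OF that] p_gt_1 by simp
  have pos: "0 < ?f e" if e: "e \<in> E" and ne: "\<rho> e \<noteq> dens \<mu> e" for e
  proof -
    have x: "0 \<le> \<rho> e" using \<rho> e by auto
    have "\<rho> e \<noteq> ?y e powr (1 / (p - 1))" using ne e by (simp add: dual_density_def)
    from strict_Young[OF p_gt_1 x y[OF e] this] show ?thesis
      using x weight_pos[OF e] by simp
  qed
  have eq: "?f e = 0" if e: "e \<in> E" and "\<rho> e = dens \<mu> e" for e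
  proof -
    have d: "\<rho> e = ?y e powr (1 / (p - 1))" using that by (simp add: dual_density_def)
    show ?thesis using Young_eq[OF p_gt_1 y[OF e] d] d by simp
  qed
  have nn: "0 \<le> ?f e" if "e \<in> E" for e
    using pos[OF that] eq[OF that] by (cases "\<rho> e = dens \<mu> e") auto
  have gap: "Lag \<rho> \<mu> - dual \<mu> = sum ?f E" by (rule lagrangian_gap)
  also have "\<dots> \<ge> 0" using nn by (rule sum_nonneg)
  finally show "dual \<mu> \<le> Lag \<rho> \<mu>" by simp
  assume "dual \<mu> = Lag \<rho> \<mu>"
  then have "sum ?f E = 0" using gap by simp
  then have "\<forall>e\<in>E. ?f e = 0" using sum_nonneg_eq_0_iff[of E ?f, OF finite_E nn] by simp
  then have "\<rho> e = dens \<mu> e" if "e \<in> E" for e using pos that by fastforce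
  then show "\<rho> = dens \<mu>" using PiE_ext[OF \<rho> dens_PiE] by blast
qed

text \<open>
  The Lagrangian is affine in the multiplier, so \<open>L(dens \<nu>, _)\<close> is an affine majorant of the
  dual objective that touches it at \<open>\<nu>\<close>.
\<close>

lemma dual_tangent:
  assumes \<mu>: "\<forall>\<gamma>\<in>\<Gamma>. 0 \<le> \<mu> \<gamma>" and \<nu>: "\<forall>\<gamma>\<in>\<Gamma>. 0 \<le> \<nu> \<gamma>"
  shows "dual \<mu> \<le> dual \<nu> + (\<Sum>\<gamma>\<in>\<Gamma>. (\<mu> \<gamma> - \<nu> \<gamma>) * (1 - len (dens \<nu>) \<gamma>))"
proof -
  have "dual \<mu> \<le> Lag (dens \<nu>) \<mu>" by (rule dual_le_lagrangian(1)[OF \<mu> dens_PiE])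
  also have "\<dots> = Lag (dens \<nu>) \<nu> + (\<Sum>\<gamma>\<in>\<Gamma>. (\<mu> \<gamma> - \<nu> \<gamma>) * (1 - len (dens \<nu>) \<gamma>))"
    by (simp add: lagrangian_def left_diff_distrib sum_subtractf)
  also have "Lag (dens \<nu>) \<nu> = dual \<nu>" by (rule dual_eq_lagrangian_dens[OF \<nu>, symmetric])
  finally show ?thesis .
qed

section \<open>Maximizers of the dual problem\<close>

text \<open>
  Loads may vanish, so continuity of the power is needed at base 0, where it takes a positive
  exponent; nonnegative multipliers keep the bases in the half-line.
\<close>

lemma powr_load_tendsto:
  assumes "\<And>\<gamma>. \<gamma> \<in> \<Gamma> \<Longrightarrow> ((\<lambda>t. \<mu> t \<gamma>) \<longlongrightarrow> \<nu> \<gamma>) F"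
    and "\<forall>\<^sub>F t in F. \<forall>\<gamma>\<in>\<Gamma>. 0 \<le> \<mu> t \<gamma>"
    and "e \<in> E" and "0 < r"
  shows "((\<lambda>t. (load N \<Gamma> (\<mu> t) e / (p * \<sigma> e)) powr r) \<longlongrightarrow> (load N \<Gamma> \<nu> e / (p * \<sigma> e)) powr r) F"
proof (rule tendsto_powr')
  have "((\<lambda>t. load N \<Gamma> (\<mu> t) e) \<longlongrightarrow> load N \<Gamma> \<nu> e) F"
    unfolding load_def using assms(1) by (intro tendsto_intros) auto
  then show "((\<lambda>t. load N \<Gamma> (\<mu> t) e / (p * \<sigma> e)) \<longlongrightarrow> load N \<Gamma> \<nu> e / (p * \<sigma> e)) F"
    using weight_pos[OF assms(3)] p_gt_1 by (intro tendsto_intros) auto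
  have "\<forall>\<^sub>F t in F. 0 \<le> load N \<Gamma> (\<mu> t) e / (p * \<sigma> e)"
    using assms(2)
  proof eventually_elim
    case (elim t)
    show ?case using load_nonneg[OF assms(3) elim] weight_pos[OF assms(3)] p_gt_1 by simp
  qed
  then show "load N \<Gamma> \<nu> e / (p * \<sigma> e) \<noteq> 0 \<or> 0 < r \<and> (\<forall>\<^sub>F t in F. 0 \<le> load N \<Gamma> (\<mu> t) e / (p * \<sigma> e))"
    using assms(4) by blast
qed simp

lemma compact_PiE_interval:
  fixes M :: real
  shows "compact (\<Gamma> \<rightarrow>\<^sub>E {0..M})"
proof -
  \<comment> \<open>Extensional functions on \<open>\<Gamma>\<close> are full functions pinned to one value outside, so Tychonoff applies.\<close>
  have "\<Gamma> \<rightarrow>\<^sub>E {0..M} = PiE UNIV (\<lambda>\<gamma>. if \<gamma> \<in> \<Gamma> then {0..M} else {undefined})"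
    by (auto simp: PiE_def Pi_def extensional_def split: if_splits; metis)
  moreover have "compactin (product_topology (\<lambda>_. euclidean) UNIV)
      (PiE UNIV (\<lambda>\<gamma>. if \<gamma> \<in> \<Gamma> then {0..M} else {undefined}))"
    unfolding compactin_PiE by auto
  ultimately show ?thesis by (simp add: euclidean_product_topology)
qed

lemma continuous_on_dual: "continuous_on (\<Gamma> \<rightarrow>\<^sub>E {0..}) dual"
  unfolding continuous_on_def
proof
  fix \<nu> assume "\<nu> \<in> \<Gamma> \<rightarrow>\<^sub>E {0::real..}"
  let ?F = "at \<nu> within (\<Gamma> \<rightarrow>\<^sub>E {0::real..})"
  have c: "((\<lambda>\<mu>. \<mu> \<gamma>) \<longlongrightarrow> \<nu> \<gamma>) ?F" for \<gamma>
    using continuous_on_product_coordinates[of \<gamma>]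
    by (metis UNIV_I continuous_on_def subset_UNIV tendsto_within_subset)
  have nn: "\<forall>\<^sub>F \<mu> in ?F. \<forall>\<gamma>\<in>\<Gamma>. 0 \<le> \<mu> \<gamma>"
    by (auto simp: eventually_at_filter intro!: always_eventually)
  show "(dual \<longlongrightarrow> dual \<nu>) ?F"
    unfolding dual_objective_load
    using p_gt_1
    by (intro tendsto_diff tendsto_sum tendsto_mult tendsto_const c powr_load_tendsto[OF c nn]) auto
qed

text \<open>
  A constant density suffices, as every object uses some edge. Any bound strictly above 1 would do:
  it is Slater's condition, and the surplus over 1 makes the dual objective coercive.
\<close>

lemma exists_long_density:
  obtains \<rho> where "\<rho> \<in> E \<rightarrow>\<^sub>E {0..}" "\<forall>\<gamma>\<in>\<Gamma>. 2 \<le> len \<rho> \<gamma>"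
proof
  have pos: "0 < sum (N \<gamma>) E" if \<gamma>: "\<gamma> \<in> \<Gamma>" for \<gamma>
  proof -
    obtain e where "e \<in> E" "0 < N \<gamma> e" using usage_nontrivial[OF \<gamma>] by blast
    then show ?thesis using sum_pos2[OF finite_E, of e "N \<gamma>"] usage_nonneg[OF \<gamma>] by auto
  qed
  let ?c = "\<Sum>\<gamma>\<in>\<Gamma>. 2 / sum (N \<gamma>) E"
  have c0: "0 \<le> ?c" by (intro sum_nonneg) (simp add: pos less_imp_le)
  then show "(\<lambda>e\<in>E. ?c) \<in> E \<rightarrow>\<^sub>E {0..}" by simp
  show "\<forall>\<gamma>\<in>\<Gamma>. 2 \<le> len (\<lambda>e\<in>E. ?c) \<gamma>"
  proof
    fix \<gamma> assume \<gamma>: "\<gamma> \<in> \<Gamma>"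
    have "2 / sum (N \<gamma>) E \<le> ?c"
      by (rule member_le_sum[OF \<gamma> _ finite_family]) (simp add: pos less_imp_le)
    then have "2 \<le> sum (N \<gamma>) E * ?c" using pos[OF \<gamma>] by (simp add: field_simps)
    also have "\<dots> = len (\<lambda>e\<in>E. ?c) \<gamma>"
      unfolding usage_length_def by (simp add: sum_distrib_right)
    finally show "2 \<le> len (\<lambda>e\<in>E. ?c) \<gamma>" .
  qed
qed

lemma dual_optimal_iff_max:
  "optimal \<mu> \<longleftrightarrow> \<mu> \<in> \<Gamma> \<rightarrow>\<^sub>E {0..} \<and> (\<forall>\<nu>\<in>\<Gamma> \<rightarrow>\<^sub>E {0..}. dual \<nu> \<le> dual \<mu>)"
  unfolding dual_optimal_def is_arg_max_def by (auto simp: not_less)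

text \<open>
  For the density \<open>\<rho>\<close> of length at least 2, weak duality gives
  \<open>dual \<nu> \<le> energy \<rho> - \<Sum>\<gamma>. \<nu> \<gamma>\<close>. So once a coordinate of \<open>\<nu>\<close> exceeds the energy of \<open>\<rho>\<close>, the
  value drops below that of the zero multiplier, and it suffices to maximize over a box.
\<close>

lemma dual_optimal_exists: obtains \<mu> where "optimal \<mu>"
proof -
  obtain \<rho> where \<rho>: "\<rho> \<in> E \<rightarrow>\<^sub>E {0..}" "\<forall>\<gamma>\<in>\<Gamma>. 2 \<le> len \<rho> \<gamma>"
    by (rule exists_long_density)
  define M where "M = energy E \<sigma> p \<rho>"
  have M0: "0 \<le> M" unfolding M_def energy_def
    by (intro sum_nonneg) (simp add: weight_pos less_imp_le)
  define Z :: "'g \<Rightarrow> real" where "Z = (\<lambda>\<gamma>\<in>\<Gamma>. 0)"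
  have Z: "Z \<in> \<Gamma> \<rightarrow>\<^sub>E {0..M}" using M0 by (auto simp: Z_def)
  have dualZ: "dual Z = 0" by (simp add: dual_objective_def Z_def)
  have "continuous_on (\<Gamma> \<rightarrow>\<^sub>E {0..M}) dual"
    by (rule continuous_on_subset[OF continuous_on_dual]) (rule PiE_mono, auto)
  then obtain \<mu> where \<mu>: "\<mu> \<in> \<Gamma> \<rightarrow>\<^sub>E {0..M}" "\<forall>\<nu>\<in>\<Gamma> \<rightarrow>\<^sub>E {0..M}. dual \<nu> \<le> dual \<mu>"
    using continuous_attains_sup[OF compact_PiE_interval] Z by blast
  have "dual \<nu> \<le> dual \<mu>" if \<nu>: "\<nu> \<in> \<Gamma> \<rightarrow>\<^sub>E {0..}" for \<nu>
  proof (cases "\<nu> \<in> \<Gamma> \<rightarrow>\<^sub>E {0..M}")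
    case False
    then obtain \<gamma> where \<gamma>: "\<gamma> \<in> \<Gamma>" "M < \<nu> \<gamma>" using \<nu> by (force simp: PiE_iff)
    have nn: "\<forall>\<gamma>\<in>\<Gamma>. 0 \<le> \<nu> \<gamma>" using \<nu> by auto
    have "dual \<nu> \<le> M + (\<Sum>\<gamma>\<in>\<Gamma>. \<nu> \<gamma> * (1 - len \<rho> \<gamma>))"
      using dual_le_lagrangian(1)[OF nn \<rho>(1)] by (simp add: lagrangian_def M_def)
    also have "(\<Sum>\<gamma>\<in>\<Gamma>. \<nu> \<gamma> * (1 - len \<rho> \<gamma>)) \<le> (\<Sum>\<gamma>\<in>\<Gamma>. \<nu> \<gamma> * (- 1))"
      using \<rho>(2) nn by (intro sum_mono mult_left_mono) force+
    also have "\<dots> \<le> - \<nu> \<gamma>"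
      using member_le_sum[OF \<gamma>(1), of \<nu>] nn finite_family by (simp add: sum_negf)
    finally have "dual \<nu> \<le> dual Z" using \<gamma> dualZ by simp
    then show ?thesis using \<mu>(2) Z by force
  qed (use \<mu> in blast)
  moreover have "\<mu> \<in> \<Gamma> \<rightarrow>\<^sub>E {0..}" using \<mu>(1) by (auto simp: PiE_iff)
  ultimately show ?thesis using that dual_optimal_iff_max by blast
qed

section \<open>Strong duality\<close>

text \<open>
  These are the Karush-Kuhn-Tucker conditions. Perturb one coordinate by \<open>t\<close> and use the tangent
  inequality at the perturbed point: optimality gives \<open>t (1 - len (dens (\<nu> t)) \<gamma>) \<le> 0\<close>. Letting
  \<open>t\<close> tend to 0 from the right yields admissibility; from the left, where \<open>\<mu> \<gamma> > 0\<close> leaves room,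
  it yields the reverse inequality.
\<close>

lemma optimal_kkt:
  assumes opt: "optimal \<mu>" and \<gamma>: "\<gamma> \<in> \<Gamma>"
  shows "1 \<le> len (dens \<mu>) \<gamma>" and "0 < \<mu> \<gamma> \<Longrightarrow> len (dens \<mu>) \<gamma> = 1"
proof -
  have \<mu>: "\<mu> \<in> \<Gamma> \<rightarrow>\<^sub>E {0..}" and max: "\<And>\<nu>. \<nu> \<in> \<Gamma> \<rightarrow>\<^sub>E {0..} \<Longrightarrow> dual \<nu> \<le> dual \<mu>"
    using opt dual_optimal_iff_max by auto
  define \<nu> where "\<nu> t = \<mu>(\<gamma> := \<mu> \<gamma> + t)" for t
  have \<nu>: "\<nu> t \<in> \<Gamma> \<rightarrow>\<^sub>E {0..}" if "0 \<le> \<mu> \<gamma> + t" for t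
    using \<mu> that \<gamma> by (auto simp: \<nu>_def PiE_iff extensional_def)
  have sign: "t * (1 - len (dens (\<nu> t)) \<gamma>) \<le> 0" if t: "0 \<le> \<mu> \<gamma> + t" for t
  proof -
    have "dual \<mu> \<le> dual (\<nu> t) + (\<Sum>\<delta>\<in>\<Gamma>. (\<mu> \<delta> - \<nu> t \<delta>) * (1 - len (dens (\<nu> t)) \<delta>))"
      using \<mu> \<nu>[OF t] by (intro dual_tangent) auto
    also have "(\<Sum>\<delta>\<in>\<Gamma>. (\<mu> \<delta> - \<nu> t \<delta>) * (1 - len (dens (\<nu> t)) \<delta>)) =
        (\<Sum>\<delta>\<in>\<Gamma>. if \<delta> = \<gamma> then - t * (1 - len (dens (\<nu> t)) \<delta>) else 0)"
      by (intro sum.cong) (auto simp: \<nu>_def)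
    also have "\<dots> = - t * (1 - len (dens (\<nu> t)) \<gamma>)" using \<gamma> finite_family by simp
    finally show ?thesis using max[OF \<nu>[OF t]] by simp
  qed
  have lim: "((\<lambda>t. len (dens (\<nu> t)) \<gamma>) \<longlongrightarrow> len (dens \<mu>) \<gamma>) F"
    if F: "F \<le> at 0" and ev: "\<forall>\<^sub>F t in F. 0 \<le> \<mu> \<gamma> + t" for F
  proof -
    have c: "((\<lambda>t. \<nu> t \<delta>) \<longlongrightarrow> \<mu> \<delta>) F" for \<delta>
    proof -
      have "((\<lambda>t. \<nu> t \<delta>) \<longlongrightarrow> \<nu> 0 \<delta>) (at 0)"
        unfolding \<nu>_def by (cases "\<delta> = \<gamma>") (auto intro!: tendsto_eq_intros)
      then show ?thesis using tendsto_mono[OF F] by (simp add: \<nu>_def)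
    qed
    have nn: "\<forall>\<^sub>F t in F. \<forall>\<delta>\<in>\<Gamma>. 0 \<le> \<nu> t \<delta>"
      using ev by eventually_elim (use \<nu> in auto)
    have "((\<lambda>t. \<Sum>e\<in>E. N \<gamma> e * (load N \<Gamma> (\<nu> t) e / (p * \<sigma> e)) powr (1 / (p - 1)))
      \<longlongrightarrow> (\<Sum>e\<in>E. N \<gamma> e * (load N \<Gamma> \<mu> e / (p * \<sigma> e)) powr (1 / (p - 1)))) F"
      using p_gt_1
      by (intro tendsto_sum tendsto_mult tendsto_const powr_load_tendsto[OF c nn]) auto
    then show ?thesis unfolding usage_length_def dual_density_def by simp
  qed
  have \<mu>\<gamma>: "0 \<le> \<mu> \<gamma>" using \<mu> \<gamma> by auto
  show ge: "1 \<le> len (dens \<mu>) \<gamma>"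
  proof (rule tendsto_lowerbound)
    have ev: "\<forall>\<^sub>F t in at_right 0. (0::real) < t" by (simp add: eventually_at_right_less)
    show "((\<lambda>t. len (dens (\<nu> t)) \<gamma>) \<longlongrightarrow> len (dens \<mu>) \<gamma>) (at_right 0)"
      using \<mu>\<gamma> by (intro lim at_le eventually_mono[OF ev]) auto
    show "\<forall>\<^sub>F t in at_right 0. 1 \<le> len (dens (\<nu> t)) \<gamma>"
    proof (rule eventually_mono[OF ev])
      fix t :: real assume "0 < t"
      then show "1 \<le> len (dens (\<nu> t)) \<gamma>" using sign[of t] \<mu>\<gamma> by (simp add: mult_le_0_iff)
    qed
  qed simp
  assume pos: "0 < \<mu> \<gamma>"
  have "len (dens \<mu>) \<gamma> \<le> 1"
  proof (rule tendsto_upperbound)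
    have ev: "\<forall>\<^sub>F t in at_left 0. - \<mu> \<gamma> < t \<and> t < 0"
      using pos eventually_at_left_real[of "- \<mu> \<gamma>" 0] by simp
    show "((\<lambda>t. len (dens (\<nu> t)) \<gamma>) \<longlongrightarrow> len (dens \<mu>) \<gamma>) (at_left 0)"
      by (intro lim at_le eventually_mono[OF ev]) auto
    show "\<forall>\<^sub>F t in at_left 0. len (dens (\<nu> t)) \<gamma> \<le> 1"
    proof (rule eventually_mono[OF ev])
      fix t :: real assume "- \<mu> \<gamma> < t \<and> t < 0"
      then show "len (dens (\<nu> t)) \<gamma> \<le> 1" using sign[of t] by (simp add: mult_le_0_iff)
    qed
  qed simp
  with ge show "len (dens \<mu>) \<gamma> = 1" by simp
qed

text \<open>
  By complementary slackness the penalty term of the Lagrangian vanishes at \<open>(dens \<mu>, \<mu>)\<close>, so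
  the energy of \<open>dens \<mu>\<close> equals the lower bound that weak duality puts on all admissible energies.
\<close>

lemma optimal_strong_duality:
  assumes opt: "optimal \<mu>"
  shows "extremal_density E \<sigma> p N \<Gamma> (dens \<mu>)" and "modul \<Gamma> = dual \<mu>"
proof -
  have \<mu>: "\<forall>\<gamma>\<in>\<Gamma>. 0 \<le> \<mu> \<gamma>" using opt by (auto simp: dual_optimal_iff_max)
  have adm: "dens \<mu> \<in> Adm E N \<Gamma>"
    using dens_PiE optimal_kkt(1)[OF opt] by (simp add: Adm_def)
  have "(\<Sum>\<gamma>\<in>\<Gamma>. \<mu> \<gamma> * (1 - len (dens \<mu>) \<gamma>)) = 0"
    using optimal_kkt(2)[OF opt] \<mu> by (intro sum.neutral) force
  then have en: "energy E \<sigma> p (dens \<mu>) = dual \<mu>"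
    using dual_eq_lagrangian_dens[OF \<mu>] by (simp add: lagrangian_def)
  have le: "dual \<mu> \<le> energy E \<sigma> p \<rho>" if \<rho>: "\<rho> \<in> Adm E N \<Gamma>" for \<rho>
  proof -
    have "dual \<mu> \<le> Lag \<rho> \<mu>" using dual_le_lagrangian(1)[OF \<mu>] \<rho> by (simp add: Adm_def)
    also have "\<dots> \<le> energy E \<sigma> p \<rho>" unfolding lagrangian_def
      using \<rho> \<mu> by (auto simp: Adm_def intro!: sum_nonpos mult_nonneg_nonpos)
    finally show ?thesis .
  qed
  show "modul \<Gamma> = dual \<mu>" unfolding Modulus_def
    using adm le by (intro cInf_eq_minimum) (auto simp: en[symmetric])
  then show "extremal_density E \<sigma> p N \<Gamma> (dens \<mu>)"
    unfolding extremal_density_def using adm en by simp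
qed

text \<open>
  An extremal density closes the duality gap with any optimal multiplier, hence attains equality in
  Young's inequality on every edge.
\<close>

lemma extremal_density_eq_dens:
  assumes opt: "optimal \<mu>" and ext: "extremal_density E \<sigma> p N \<Gamma> \<rho>"
  shows "\<rho> = dens \<mu>"
proof -
  have \<mu>: "\<forall>\<gamma>\<in>\<Gamma>. 0 \<le> \<mu> \<gamma>" using opt by (auto simp: dual_optimal_iff_max)
  have \<rho>: "\<rho> \<in> E \<rightarrow>\<^sub>E {0..}" "\<forall>\<gamma>\<in>\<Gamma>. 1 \<le> len \<rho> \<gamma>" and en: "energy E \<sigma> p \<rho> = dual \<mu>"
    using ext optimal_strong_duality(2)[OF opt] by (auto simp: extremal_density_def Adm_def)
  have "Lag \<rho> \<mu> \<le> energy E \<sigma> p \<rho>" unfolding lagrangian_def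
    using \<rho> \<mu> by (auto intro!: sum_nonpos mult_nonneg_nonpos)
  then have "dual \<mu> = Lag \<rho> \<mu>" using dual_le_lagrangian(1)[OF \<mu> \<rho>(1)] en by simp
  then show ?thesis by (rule dual_le_lagrangian(2)[OF \<mu> \<rho>(1)])
qed

lemma optimal_iff_modulus:
  "optimal \<mu> \<longleftrightarrow> \<mu> \<in> \<Gamma> \<rightarrow>\<^sub>E {0..} \<and> dual \<mu> = modul \<Gamma>"
proof -
  obtain \<nu> where \<nu>: "optimal \<nu>" by (rule dual_optimal_exists)
  show ?thesis
    using optimal_strong_duality(2)[OF \<nu>] optimal_strong_duality(2)[of \<mu>] \<nu>
    unfolding dual_optimal_iff_max by auto
qed

lemma optimal_load_unique:
  assumes "optimal \<mu>" and "optimal \<nu>" and e: "e \<in> E"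
  shows "load N \<Gamma> \<mu> e = load N \<Gamma> \<nu> e"
proof -
  have root: "(load N \<Gamma> \<kappa> e / (p * \<sigma> e)) = dens \<kappa> e powr (p - 1)" if "optimal \<kappa>" for \<kappa>
  proof -
    have "0 \<le> load N \<Gamma> \<kappa> e" using that e by (intro load_nonneg) (auto simp: dual_optimal_iff_max)
    then show ?thesis
      using e p_gt_1 weight_pos[OF e] by (simp add: dual_density_def powr_powr)
  qed
  have "dens \<mu> = dens \<nu>"
    by (rule extremal_density_eq_dens[OF assms(2) optimal_strong_duality(1)[OF assms(1)]])
  then have "load N \<Gamma> \<mu> e / (p * \<sigma> e) = load N \<Gamma> \<nu> e / (p * \<sigma> e)"
    using root assms by simp
  then show ?thesis using p_gt_1 weight_pos[OF e] by simp
qed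

text \<open>
  Up to the factor \<open>p\<close>, the weight \<open>\<rho>(e)^(p-1) \<sigma>(e)\<close> is the load of the optimal multiplier. So the
  Beurling functional of \<open>h\<close> is a combination of the lengths \<open>len h \<gamma>\<close> with nonnegative
  coefficients that vanish off the support.
\<close>

lemma beurling_if_lagrangian:
  assumes opt: "optimal \<mu>"
  shows "beurling_subfamily E \<sigma> p N \<Gamma> (lagrangian_subfamily \<Gamma> \<mu>)"
proof -
  have \<mu>: "\<forall>\<gamma>\<in>\<Gamma>. 0 \<le> \<mu> \<gamma>" using opt by (auto simp: dual_optimal_iff_max)
  have "0 \<le> (\<Sum>e\<in>E. h e * dens \<mu> e powr (p - 1) * \<sigma> e)"
    if h: "\<forall>\<gamma>\<in>lagrangian_subfamily \<Gamma> \<mu>. 0 \<le> len h \<gamma>" for h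
  proof -
    have "h e * dens \<mu> e powr (p - 1) * \<sigma> e = load N \<Gamma> \<mu> e * h e / p" if e: "e \<in> E" for e
      using e p_gt_1 weight_pos[OF e] load_nonneg[OF e \<mu>]
      by (simp add: dual_density_def powr_powr)
    then have "(\<Sum>e\<in>E. h e * dens \<mu> e powr (p - 1) * \<sigma> e) = (\<Sum>\<gamma>\<in>\<Gamma>. \<mu> \<gamma> * len h \<gamma>) / p"
      by (simp add: sum_mult_usage_length sum_divide_distrib)
    moreover have "0 \<le> \<mu> \<gamma> * len h \<gamma>" if "\<gamma> \<in> \<Gamma>" for \<gamma>
      using h \<mu> that by (cases "0 < \<mu> \<gamma>") (auto simp: lagrangian_subfamily_def)
    ultimately show ?thesis using p_gt_1 by (simp add: sum_nonneg)
  qed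
  then show ?thesis unfolding beurling_subfamily_def
    using optimal_strong_duality(1)[OF opt] optimal_kkt(2)[OF opt]
    by (auto simp: lagrangian_subfamily_def intro!: exI[of _ "dens \<mu>"])
qed

section \<open>Minimal subfamilies\<close>

lemma modulus_mono:
  assumes "\<Delta> \<subseteq> \<Gamma>"
  shows "modul \<Delta> \<le> modul \<Gamma>"
proof -
  obtain \<mu> where \<mu>: "optimal \<mu>" by (rule dual_optimal_exists)
  have "bdd_below (energy E \<sigma> p ` Adm E N \<Delta>)"
    by (rule bdd_belowI2[of _ 0]) (simp add: energy_def sum_nonneg weight_pos less_imp_le)
  moreover have "Adm E N \<Gamma> \<subseteq> Adm E N \<Delta>" using assms by (auto simp: Adm_def)
  moreover have "Adm E N \<Gamma> \<noteq> {}"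
    using optimal_strong_duality(1)[OF \<mu>] by (auto simp: extremal_density_def)
  ultimately show ?thesis unfolding Modulus_def by (intro cINF_superset_mono) auto
qed

text \<open>
  Extending by zero an optimal multiplier of \<open>\<Delta>\<close> gives a multiplier of \<open>\<Gamma>\<close> with dual value
  \<open>modul \<Delta>\<close>; restricting an optimal multiplier of \<open>\<Gamma>\<close> supported in \<open>\<Delta>\<close> gives one of \<open>\<Delta>\<close> with
  dual value \<open>modul \<Gamma>\<close>. Strong duality for both families turns these values into moduli.
\<close>

lemma modulus_eq_iff_optimal_support:
  assumes \<Delta>: "\<Delta> \<subseteq> \<Gamma>"
  shows "modul \<Delta> = modul \<Gamma> \<longleftrightarrow> (\<exists>\<mu>. optimal \<mu> \<and> lagrangian_subfamily \<Gamma> \<mu> \<subseteq> \<Delta>)"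
proof
  interpret sub: finite_object_family V E ends \<sigma> \<Delta> N p by (rule subfamily[OF \<Delta>])
  show "\<exists>\<mu>. optimal \<mu> \<and> lagrangian_subfamily \<Gamma> \<mu> \<subseteq> \<Delta>" if eq: "modul \<Delta> = modul \<Gamma>"
  proof -
    obtain \<nu> where \<nu>: "sub.optimal \<nu>" by (rule sub.dual_optimal_exists)
    define \<mu> where "\<mu> = (\<lambda>\<gamma>\<in>\<Gamma>. if \<gamma> \<in> \<Delta> then \<nu> \<gamma> else 0)"
    have "sub.dual \<nu> = dual \<mu>"
      by (rule dual_objective_subfamily[OF finite_family \<Delta>]) (use \<Delta> in \<open>auto simp: \<mu>_def\<close>)
    then have "dual \<mu> = modul \<Gamma>" using \<nu> eq sub.optimal_iff_modulus by simp
    moreover have "\<mu> \<in> \<Gamma> \<rightarrow>\<^sub>E {0..}"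
      using \<nu> sub.optimal_iff_modulus by (auto simp: \<mu>_def PiE_iff)
    ultimately show ?thesis
      by (auto simp: optimal_iff_modulus \<mu>_def lagrangian_subfamily_def split: if_splits
          intro!: exI[of _ \<mu>])
  qed
  assume "\<exists>\<mu>. optimal \<mu> \<and> lagrangian_subfamily \<Gamma> \<mu> \<subseteq> \<Delta>"
  then obtain \<mu> where \<mu>: "optimal \<mu>" "lagrangian_subfamily \<Gamma> \<mu> \<subseteq> \<Delta>" by blast
  have nn: "\<forall>\<gamma>\<in>\<Gamma>. 0 \<le> \<mu> \<gamma>" using \<mu>(1) by (auto simp: dual_optimal_iff_max)
  have zero: "\<forall>\<gamma>\<in>\<Gamma> - \<Delta>. \<mu> \<gamma> = 0"
    using nn \<mu>(2) by (force simp: lagrangian_subfamily_def)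
  obtain \<nu> where \<nu>: "sub.optimal \<nu>" by (rule sub.dual_optimal_exists)
  have "modul \<Gamma> = sub.dual (restrict \<mu> \<Delta>)"
    unfolding optimal_strong_duality(2)[OF \<mu>(1)]
    by (rule dual_objective_subfamily[OF finite_family \<Delta> _ zero, symmetric]) simp
  also have "sub.dual (restrict \<mu> \<Delta>) \<le> sub.dual \<nu>"
  proof -
    have "restrict \<mu> \<Delta> \<in> \<Delta> \<rightarrow>\<^sub>E {0..}" using nn \<Delta> by auto
    then show ?thesis using \<nu> sub.dual_optimal_iff_max by blast
  qed
  also have "\<dots> = modul \<Delta>" by (rule sub.optimal_strong_duality(2)[OF \<nu>, symmetric])
  finally show "modul \<Delta> = modul \<Gamma>" using modulus_mono[OF \<Delta>] by simp
qed

abbreviation minimal where "minimal \<equiv> minimal_subfamily E \<sigma> p N \<Gamma>"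

lemma minimal_subfamily_exists: "\<exists>\<Delta>. minimal \<Delta>"
proof -
  define \<Delta> where "\<Delta> = arg_min card (\<lambda>\<Delta>. \<Delta> \<subseteq> \<Gamma> \<and> modul \<Delta> = modul \<Gamma>)"
  have \<Delta>: "\<Delta> \<subseteq> \<Gamma>" "modul \<Delta> = modul \<Gamma>"
    and least: "\<And>\<Delta>'. \<Delta>' \<subseteq> \<Gamma> \<Longrightarrow> modul \<Delta>' = modul \<Gamma> \<Longrightarrow> card \<Delta> \<le> card \<Delta>'"
    using arg_min_nat_lemma[of "\<lambda>\<Delta>. \<Delta> \<subseteq> \<Gamma> \<and> modul \<Delta> = modul \<Gamma>" \<Gamma> card]
    by (auto simp: \<Delta>_def)
  have "modul (\<Delta> - {\<gamma>}) < modul \<Gamma>" if "\<gamma> \<in> \<Delta>" for \<gamma>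
  proof -
    have "card (\<Delta> - {\<gamma>}) < card \<Delta>"
      using that \<Delta>(1) finite_family by (meson card_Diff1_less finite_subset)
    then have "modul (\<Delta> - {\<gamma>}) \<noteq> modul \<Gamma>" using least[of "\<Delta> - {\<gamma>}"] \<Delta>(1) by force
    moreover have "modul (\<Delta> - {\<gamma>}) \<le> modul \<Gamma>" using \<Delta>(1) by (intro modulus_mono) auto
    ultimately show ?thesis by simp
  qed
  then show ?thesis using \<Delta> by (auto simp: minimal_subfamily_def)
qed

text \<open>
  An object of \<open>\<Delta>\<close> outside the support could be removed without changing the modulus.
\<close>

lemma minimal_support:
  assumes min: "minimal \<Delta>" and \<mu>: "optimal \<mu>" and sub: "lagrangian_subfamily \<Gamma> \<mu> \<subseteq> \<Delta>"
  shows "lagrangian_subfamily \<Gamma> \<mu> = \<Delta>"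
proof (rule ccontr)
  assume "lagrangian_subfamily \<Gamma> \<mu> \<noteq> \<Delta>"
  then obtain \<gamma> where \<gamma>: "\<gamma> \<in> \<Delta>" "lagrangian_subfamily \<Gamma> \<mu> \<subseteq> \<Delta> - {\<gamma>}" using sub by blast
  moreover have "\<Delta> - {\<gamma>} \<subseteq> \<Gamma>" using min by (auto simp: minimal_subfamily_def)
  ultimately have "modul (\<Delta> - {\<gamma>}) = modul \<Gamma>"
    using \<mu> modulus_eq_iff_optimal_support by blast
  then show False using min \<gamma>(1) by (auto simp: minimal_subfamily_def)
qed

lemma minimal_eq_lagrangian:
  assumes "minimal \<Delta>"
  obtains \<mu> where "optimal \<mu>" "lagrangian_subfamily \<Gamma> \<mu> = \<Delta>"
  using assms minimal_support[OF assms] modulus_eq_iff_optimal_support[of \<Delta>]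
  by (auto simp: minimal_subfamily_def)

text \<open>
  Take the optimal multiplier \<open>\<mu>\<close> with support \<open>\<Delta>\<close> and a nontrivial relation \<open>c\<close> between the rows.
  Pairing the relation with the extremal density, along which all lengths in \<open>\<Delta>\<close> are 1, shows that the
  coefficients of \<open>c\<close> sum to 0. So \<open>\<mu> + t c\<close> has the loads and the total mass of \<open>\<mu>\<close>, hence the same
  dual value, while some coefficient is negative. At the largest \<open>t\<close> that keeps all coordinates
  nonnegative, an object of \<open>\<Delta>\<close> drops out of the support, against minimality.
\<close>

lemma minimal_independent:
  assumes min: "minimal \<Delta>" and rel: "\<And>e. e \<in> E \<Longrightarrow> (\<Sum>\<gamma>\<in>\<Delta>. c \<gamma> * N \<gamma> e) = 0"
    and \<gamma>: "\<gamma> \<in> \<Delta>"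
  shows "c \<gamma> = 0"
proof (rule ccontr)
  assume c\<gamma>: "c \<gamma> \<noteq> 0"
  obtain \<mu> where \<mu>: "optimal \<mu>" and supp: "lagrangian_subfamily \<Gamma> \<mu> = \<Delta>"
    using minimal_eq_lagrangian[OF min] by blast
  have \<Delta>: "\<Delta> \<subseteq> \<Gamma>" and fin: "finite \<Delta>" and pos: "\<And>\<gamma>. \<gamma> \<in> \<Delta> \<Longrightarrow> 0 < \<mu> \<gamma>"
    using supp finite_family by (auto simp: lagrangian_subfamily_def)
  have \<mu>P: "\<mu> \<in> \<Gamma> \<rightarrow>\<^sub>E {0..}" using \<mu> by (simp add: dual_optimal_iff_max)
  have "(\<Sum>\<gamma>\<in>\<Delta>. c \<gamma>) = (\<Sum>\<gamma>\<in>\<Delta>. c \<gamma> * len (dens \<mu>) \<gamma>)"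
    using optimal_kkt(2)[OF \<mu>] \<Delta> pos by (intro sum.cong) auto
  also have "\<dots> = 0" using rel by (simp add: sum_mult_usage_length load_def)
  finally have sum0: "sum c \<Delta> = 0" .
  define D where "D = {\<gamma>\<in>\<Delta>. c \<gamma> < 0}"
  have finD: "finite D" using fin by (simp add: D_def)
  have "D \<noteq> {}"
  proof
    assume "D = {}"
    then have "\<And>\<gamma>. \<gamma> \<in> \<Delta> \<Longrightarrow> 0 \<le> c \<gamma>" by (force simp: D_def)
    then show False using sum_nonneg_eq_0_iff[OF fin, of c] sum0 \<gamma> c\<gamma> by blast
  qed
  define t where "t = Min ((\<lambda>\<gamma>. \<mu> \<gamma> / - c \<gamma>) ` D)"
  have "t \<in> (\<lambda>\<gamma>. \<mu> \<gamma> / - c \<gamma>) ` D"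
    unfolding t_def using finD \<open>D \<noteq> {}\<close> by (intro Min_in) auto
  then obtain \<delta> where \<delta>: "\<delta> \<in> D" "t = \<mu> \<delta> / - c \<delta>" by blast
  have t0: "0 < t" using \<delta> pos by (simp add: D_def divide_pos_neg)
  define d where "d \<gamma> = (if \<gamma> \<in> \<Delta> then c \<gamma> else 0)" for \<gamma>
  define \<nu> where "\<nu> = (\<lambda>\<gamma>\<in>\<Gamma>. \<mu> \<gamma> + t * d \<gamma>)"
  have "0 \<le> \<mu> \<gamma> + t * d \<gamma>" if "\<gamma> \<in> \<Gamma>" for \<gamma>
  proof (cases "\<gamma> \<in> D")
    case True
    then have "t \<le> \<mu> \<gamma> / - c \<gamma>" unfolding t_def using finD by (intro Min_le) auto
    then show ?thesis using True by (simp add: D_def d_def field_simps)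
  next
    case False
    then have "0 \<le> d \<gamma>" by (auto simp: D_def d_def)
    then show ?thesis using t0 \<mu>P that by (auto simp: PiE_iff)
  qed
  then have \<nu>P: "\<nu> \<in> \<Gamma> \<rightarrow>\<^sub>E {0..}" by (auto simp: \<nu>_def)
  have sumd: "(\<Sum>\<gamma>\<in>\<Gamma>. d \<gamma> * w \<gamma>) = (\<Sum>\<gamma>\<in>\<Delta>. c \<gamma> * w \<gamma>)" for w :: "'g \<Rightarrow> real"
    using finite_family \<Delta> by (intro sum.mono_neutral_cong_right) (auto simp: d_def)
  have shift: "(\<Sum>\<gamma>\<in>\<Gamma>. \<nu> \<gamma> * w \<gamma>) = (\<Sum>\<gamma>\<in>\<Gamma>. \<mu> \<gamma> * w \<gamma>)"
    if "(\<Sum>\<gamma>\<in>\<Delta>. c \<gamma> * w \<gamma>) = 0" for w :: "'g \<Rightarrow> real"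
  proof -
    have "(\<Sum>\<gamma>\<in>\<Gamma>. \<nu> \<gamma> * w \<gamma>) = (\<Sum>\<gamma>\<in>\<Gamma>. \<mu> \<gamma> * w \<gamma>) + t * (\<Sum>\<gamma>\<in>\<Gamma>. d \<gamma> * w \<gamma>)"
      by (simp add: \<nu>_def sum.distrib sum_distrib_left algebra_simps)
    then show ?thesis using that sumd by simp
  qed
  have "dual \<nu> = dual \<mu>"
    unfolding dual_objective_def using shift[of "\<lambda>_. 1"] sum0 shift rel by simp
  then have "optimal \<nu>" using \<nu>P \<mu> by (simp add: optimal_iff_modulus)
  moreover have "lagrangian_subfamily \<Gamma> \<nu> \<subseteq> \<Delta>"
  proof
    fix \<gamma> assume "\<gamma> \<in> lagrangian_subfamily \<Gamma> \<nu>"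
    then have "\<gamma> \<in> \<Gamma>" "0 < \<mu> \<gamma> + t * d \<gamma>" by (auto simp: lagrangian_subfamily_def \<nu>_def)
    then show "\<gamma> \<in> \<Delta>" using supp by (cases "\<gamma> \<in> \<Delta>") (auto simp: d_def lagrangian_subfamily_def)
  qed
  ultimately have "lagrangian_subfamily \<Gamma> \<nu> = \<Delta>" by (rule minimal_support[OF min])
  moreover have "\<nu> \<delta> = 0" using \<delta> \<Delta> by (auto simp: \<nu>_def d_def D_def)
  ultimately show False using \<delta>(1) by (auto simp: D_def lagrangian_subfamily_def)
qed

text \<open>
  Optimal multipliers have equal loads, so the difference of two that are supported on \<open>\<Delta>\<close> is a
  linear relation between the rows of \<open>\<Delta>\<close>.
\<close>

lemma minimal_optimal_unique:
  assumes min: "minimal \<Delta>"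
  shows "\<exists>!\<mu>. optimal \<mu> \<and> \<Delta> = lagrangian_subfamily \<Gamma> \<mu>"
proof (rule ex_ex1I)
  show "\<exists>\<mu>. optimal \<mu> \<and> \<Delta> = lagrangian_subfamily \<Gamma> \<mu>"
    using minimal_eq_lagrangian[OF min] by metis
  fix \<mu> \<nu>
  assume \<mu>: "optimal \<mu> \<and> \<Delta> = lagrangian_subfamily \<Gamma> \<mu>"
    and \<nu>: "optimal \<nu> \<and> \<Delta> = lagrangian_subfamily \<Gamma> \<nu>"
  have P: "\<mu> \<in> \<Gamma> \<rightarrow>\<^sub>E {0..}" "\<nu> \<in> \<Gamma> \<rightarrow>\<^sub>E {0..}"
    using \<mu> \<nu> by (auto simp: dual_optimal_iff_max)
  have \<Delta>: "\<Delta> \<subseteq> \<Gamma>" using min by (simp add: minimal_subfamily_def)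
  have out: "\<mu> \<gamma> = 0" "\<nu> \<gamma> = 0" if "\<gamma> \<in> \<Gamma> - \<Delta>" for \<gamma>
  proof -
    have "\<not> 0 < \<mu> \<gamma>" "\<not> 0 < \<nu> \<gamma>" using \<mu> \<nu> that by (auto simp: lagrangian_subfamily_def)
    moreover have "0 \<le> \<mu> \<gamma>" "0 \<le> \<nu> \<gamma>" using P that by auto
    ultimately show "\<mu> \<gamma> = 0" "\<nu> \<gamma> = 0" by auto
  qed
  have "(\<Sum>\<gamma>\<in>\<Delta>. (\<mu> \<gamma> - \<nu> \<gamma>) * N \<gamma> e) = 0" if e: "e \<in> E" for e
  proof -
    have "(\<Sum>\<gamma>\<in>\<Delta>. (\<mu> \<gamma> - \<nu> \<gamma>) * N \<gamma> e) = (\<Sum>\<gamma>\<in>\<Gamma>. (\<mu> \<gamma> - \<nu> \<gamma>) * N \<gamma> e)"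
      using finite_family \<Delta> out by (intro sum.mono_neutral_left) auto
    also have "\<dots> = load N \<Gamma> \<mu> e - load N \<Gamma> \<nu> e"
      by (simp add: load_def left_diff_distrib sum_subtractf)
    finally show ?thesis using optimal_load_unique[OF _ _ e] \<mu> \<nu> by simp
  qed
  then have "\<mu> \<gamma> - \<nu> \<gamma> = 0" if "\<gamma> \<in> \<Delta>" for \<gamma>
    using minimal_independent[OF min, of "\<lambda>\<gamma>. \<mu> \<gamma> - \<nu> \<gamma>"] that by blast
  then have "\<mu> \<gamma> = \<nu> \<gamma>" if "\<gamma> \<in> \<Gamma>" for \<gamma> using out that by (cases "\<gamma> \<in> \<Delta>") auto
  then show "\<mu> = \<nu>" by (rule PiE_ext[OF P])
qed

lemma minimal_rank:
  assumes min: "minimal \<Delta>"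
  shows "matrix_rank (usage_matrix E N \<Delta>) = card \<Delta>"
proof -
  let ?A = "usage_matrix E N \<Delta>"
  have fin: "finite \<Delta>" using min finite_family finite_subset by (auto simp: minimal_subfamily_def)
  have A: "?A \<in> carrier_mat (card \<Delta>) (card E)" by (simp add: usage_matrix_def)
  have "vec_space.rank (card \<Delta>) ?A = card \<Delta>"
  proof (rule rank_eq_dim_row_if_rows_independent[OF A])
    fix c :: "real Matrix.vec"
    assume c: "c \<in> carrier_vec (card \<Delta>)" and z: "?A\<^sup>T *\<^sub>v c = 0\<^sub>v (card E)"
    define f where "f \<gamma> = c $ to_nat_on \<Delta> \<gamma>" for \<gamma>
    have f: "f (from_nat_into \<Delta> i) = c $ i" if "i < card \<Delta>" for i
      using that to_nat_on_finite[OF fin] by (simp add: f_def bij_betw_def)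
    have "(\<Sum>\<gamma>\<in>\<Delta>. f \<gamma> * N \<gamma> e) = 0" if "e \<in> E" for e
    proof -
      obtain j where j: "j < card E" "e = from_nat_into E j"
      proof -
        have "e \<in> from_nat_into E ` {..<card E}"
          using bij_betw_imp_surj_on[OF bij_betw_from_nat_into_finite[OF finite_E]] \<open>e \<in> E\<close> by simp
        then show ?thesis using that by (elim imageE) simp
      qed
      have "(\<Sum>\<gamma>\<in>\<Delta>. f \<gamma> * N \<gamma> e) =
          (\<Sum>i<card \<Delta>. f (from_nat_into \<Delta> i) * N (from_nat_into \<Delta> i) e)"
        by (rule sum.card_from_nat_into[symmetric])
      also have "\<dots> = (\<Sum>i<card \<Delta>. N (from_nat_into \<Delta> i) e * c $ i)"
        using f by (intro sum.cong) auto
      also have "\<dots> = (?A\<^sup>T *\<^sub>v c) $ j"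
        using j c by (simp add: usage_matrix_def scalar_prod_def lessThan_atLeast0)
      finally show ?thesis using z j by simp
    qed
    then have f0: "f \<gamma> = 0" if "\<gamma> \<in> \<Delta>" for \<gamma> using minimal_independent[OF min] that by blast
    show "c = 0\<^sub>v (card \<Delta>)"
    proof (rule eq_vecI)
      fix i assume "i < dim_vec (0\<^sub>v (card \<Delta>) :: real Matrix.vec)"
      then have i: "i < card \<Delta>" by simp
      then have "from_nat_into \<Delta> i \<in> \<Delta>" by (intro from_nat_into) auto
      then show "c $ i = 0\<^sub>v (card \<Delta>) $ i" using f[OF i] f0 i by simp
    qed (use c in simp)
  qed
  then show ?thesis using A by (simp add: matrix_rank_def)
qed

lemma minimal_card_le:
  assumes "minimal \<Delta>"
  shows "card \<Delta> \<le> card E"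
proof -
  have "usage_matrix E N \<Delta> \<in> carrier_mat (card \<Delta>) (card E)" by (simp add: usage_matrix_def)
  from vec_space.rank_le_nc[OF this] minimal_rank[OF assms] show ?thesis
    by (simp add: matrix_rank_def usage_matrix_def)
qed

end

theorem theorem3p5:
  fixes V :: "'v set" and E :: "'e set" and ends :: "'e \<Rightarrow> 'v set" and \<sigma> :: "'e \<Rightarrow> real"
    and \<Gamma> :: "'g set" and N :: "'g \<Rightarrow> 'e \<Rightarrow> real" and p :: real
  assumes "1 < p"
    and "object_family V E ends \<sigma> \<Gamma> N"
    and "finite \<Gamma>"
  shows "(\<exists>\<Delta>. minimal_subfamily E \<sigma> p N \<Gamma> \<Delta>) \<and>
    (\<forall>\<Delta>. minimal_subfamily E \<sigma> p N \<Gamma> \<Delta> \<longrightarrow>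
       (\<exists>!\<mu>. dual_optimal E \<sigma> p N \<Gamma> \<mu> \<and> \<Delta> = lagrangian_subfamily \<Gamma> \<mu>) \<and>
       beurling_subfamily E \<sigma> p N \<Gamma> \<Delta>) \<and>
    (\<forall>\<Delta>. minimal_subfamily E \<sigma> p N \<Gamma> \<Delta> \<longrightarrow>
       matrix_rank (usage_matrix E N \<Delta>) = card \<Delta>) \<and>
    (\<forall>\<Delta>. minimal_subfamily E \<sigma> p N \<Gamma> \<Delta> \<longrightarrow> card \<Delta> \<le> card E) \<and>
    (minimal_subfamily E \<sigma> p N \<Gamma> \<Gamma> \<longrightarrow> (\<exists>!\<mu>. dual_optimal E \<sigma> p N \<Gamma> \<mu>))"
proof -
  interpret finite_object_family V E ends \<sigma> \<Gamma> N p
    using assms by (simp add: finite_object_family_def finite_object_family_axioms_def)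
  have "beurling_subfamily E \<sigma> p N \<Gamma> \<Delta>" if "minimal \<Delta>" for \<Delta>
    using minimal_eq_lagrangian[OF that] beurling_if_lagrangian by metis
  moreover have "\<exists>!\<mu>. optimal \<mu>" if min: "minimal \<Gamma>"
  proof -
    have "\<Gamma> = lagrangian_subfamily \<Gamma> \<mu>" if "optimal \<mu>" for \<mu>
      by (rule minimal_support[OF min that, symmetric]) (auto simp: lagrangian_subfamily_def)
    then show ?thesis using minimal_optimal_unique[OF min] by metis
  qed
  ultimately show ?thesis
    using minimal_subfamily_exists minimal_optimal_unique minimal_rank minimal_card_le by blast
qed

end
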